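(* Let $\mathcal V=\ker d_0^*\subset C^1(K)$ be the divergence-free edge-cochain space of a finite oriented two-dimensional cell complex $K$, let $P:C^1(K)\to\mathcal V$ be the orthogonal projector, let $\Delta_1=d_0d_0^*+d_1^*d_1$, let $\nu,\eta>0$, let $f,g\in C^1(K)$ be time-independent, and let $B:\mathcal V\times\mathcal V\to\mathcal V$ be a continuous bilinear map with $\langle B(a,b),c\rangle=-\langle B(a,c),b\rangle$ for all $a,b,c\in\mathcal V$. Let $(u,h)$ be any solution in $\mathcal V\times\mathcal V$ of $$\dot u=-\nu\Delta_1u+B(u,u)-B(h,h)+Pf,\qquad \dot h=-\eta\Delta_1h+B(u,h)-B(h,u)+Pg,$$ and set $E(t)=\|u(t)\|^2+\|h(t)\|^2$. Then $$\frac12\frac{dE}{dt}+\nu\|\Delta_1^{1/2}u\|^2+\eta\|\Delta_1^{1/2}h\|^2=\langle Pf,u\rangle+\langle Pg,h\rangle.$$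
   Context: $K$ is a finite oriented two-dimensional cell complex. The finite-dimensional real cochain spaces $C^q(K)$, $q=0,1,2$, carry fixed Euclidean inner products $\langle\cdot,\cdot\rangle$ with norms $\|\cdot\|$. The coboundary operators $d_0:C^0(K)\to C^1(K)$ and $d_1:C^1(K)\to C^2(K)$ are linear with $d_1d_0=0$; stars denote adjoints. The space $\mathcal V$ is invariant under $\Delta_1$. $\Delta_1^{1/2}$ is the nonnegative self-adjoint square root of the nonnegative self-adjoint operator $\Delta_1$, so $\|\Delta_1^{1/2}v\|^2=\langle\Delta_1v,v\rangle$. *)

theory Defs
  imports "HOL-Analysis.Analysis"
begin

text \<open>
  A finite two-dimensional cell complex is given combinatorially: an edge runs from its tail to
  its head (its orientation; loops and multiple edges are allowed), and a 2-cell is glued along a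
  closed edge path based at some vertex, whose direction of travel is the orientation of the
  2-cell. In a path, the pair \<open>(e, True)\<close> stands for the edge \<open>e\<close> traversed from tail to head and
  \<open>(e, False)\<close> for the same edge traversed backwards. The empty path is the constant attaching map.
  The cells are subsets of finite label types, so that each set of cells may be empty.
\<close>

record ('v, 'e, 'f) complex2 =
  verts :: "'v set"
  edges :: "'e set"
  faces :: "'f set"
  tail :: "'e \<Rightarrow> 'v"
  head :: "'e \<Rightarrow> 'v"
  base :: "'f \<Rightarrow> 'v"
  attach :: "'f \<Rightarrow> ('e \<times> bool) list"

fun edge_path :: "('v, 'e, 'f) complex2 \<Rightarrow> 'v \<Rightarrow> ('e \<times> bool) list \<Rightarrow> 'v \<Rightarrow> bool" where
  "edge_path K x [] y \<longleftrightarrow> x \<in> verts K \<and> x = y"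
| "edge_path K x ((e, s) # p) y \<longleftrightarrow> e \<in> edges K \<and>
     x = (if s then tail K e else head K e) \<and>
     edge_path K (if s then head K e else tail K e) p y"

definition cell_complex2 :: "('v::finite, 'e::finite, 'f::finite) complex2 \<Rightarrow> bool" where
  "cell_complex2 K \<longleftrightarrow>
     (\<forall>e\<in>edges K. tail K e \<in> verts K \<and> head K e \<in> verts K) \<and>
     (\<forall>\<phi>\<in>faces K. edge_path K (base K \<phi>) (attach K \<phi>) (base K \<phi>))"

text \<open>
  Real cochains are the functions on the label type that vanish off the cells of \<open>K\<close>.
\<close>

definition C0 :: "('v::finite, 'e::finite, 'f::finite) complex2 \<Rightarrow> (real ^ 'v) set" where
  "C0 K = {x. \<forall>v. v \<notin> verts K \<longrightarrow> x $ v = 0}"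

definition C1 :: "('v::finite, 'e::finite, 'f::finite) complex2 \<Rightarrow> (real ^ 'e) set" where
  "C1 K = {x. \<forall>e. e \<notin> edges K \<longrightarrow> x $ e = 0}"

definition C2 :: "('v::finite, 'e::finite, 'f::finite) complex2 \<Rightarrow> (real ^ 'f) set" where
  "C2 K = {x. \<forall>\<phi>. \<phi> \<notin> faces K \<longrightarrow> x $ \<phi> = 0}"

definition d0 :: "('v::finite, 'e::finite, 'f::finite) complex2 \<Rightarrow> real ^ 'v \<Rightarrow> real ^ 'e" where
  "d0 K x = (\<chi> e. if e \<in> edges K then x $ head K e - x $ tail K e else 0)"

definition path_sum :: "real ^ 'e \<Rightarrow> ('e::finite \<times> bool) list \<Rightarrow> real" where
  "path_sum y p = (\<Sum>(e, s)\<leftarrow>p. if s then y $ e else - (y $ e))"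

definition d1 :: "('v::finite, 'e::finite, 'f::finite) complex2 \<Rightarrow> real ^ 'e \<Rightarrow> real ^ 'f" where
  "d1 K y = (\<chi> \<phi>. if \<phi> \<in> faces K then path_sum y (attach K \<phi>) else 0)"

lemma linear_d0: "linear (d0 K)"
  by (rule linearI) (auto simp: d0_def vec_eq_iff algebra_simps)

lemma linear_d1: "linear (d1 K)"
proof -
  have "path_sum (x + y) p = path_sum x p + path_sum y p" for x y :: "real ^ 'e::finite" and p
    by (induction p) (auto simp: path_sum_def)
  moreover have "path_sum (c *\<^sub>R x) p = c * path_sum x p" for c and x :: "real ^ 'e::finite" and p
    by (induction p) (auto simp: path_sum_def algebra_simps)
  ultimately show ?thesis
    by (intro linearI) (auto simp: d1_def vec_eq_iff)
qed

lemma d0_C1: "d0 K x \<in> C1 K"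
  by (simp add: d0_def C1_def)

lemma d1_C2: "d1 K y \<in> C2 K"
  by (simp add: d1_def C2_def)

lemma path_sum_d0: "edge_path K a p b \<Longrightarrow> path_sum (d0 K x) p = x $ b - x $ a"
  by (induction K a p b rule: edge_path.induct) (auto simp: path_sum_def d0_def split: if_splits)

lemma d1_d0: "cell_complex2 K \<Longrightarrow> d1 K (d0 K x) = 0"
  by (auto simp: d1_def cell_complex2_def vec_eq_iff path_sum_d0)

text \<open>
  The inner products on the cochain spaces are arbitrary, and in general different from the
  standard one on \<open>real ^ 'n\<close>. Adjoints, orthogonal projections, norms and
  square roots are therefore taken with respect to an inner product that is passed as a parameter
  and is only meaningful on the given subspace.
\<close>

definition inner_product_on :: "'a::real_vector set \<Rightarrow> ('a \<Rightarrow> 'a \<Rightarrow> real) \<Rightarrow> bool" where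
  "inner_product_on S ip \<longleftrightarrow>
     (\<forall>x\<in>S. \<forall>y\<in>S. ip x y = ip y x) \<and>
     (\<forall>x\<in>S. \<forall>y\<in>S. \<forall>z\<in>S. ip (x + y) z = ip x z + ip y z) \<and>
     (\<forall>c. \<forall>x\<in>S. \<forall>y\<in>S. ip (c *\<^sub>R x) y = c * ip x y) \<and>
     (\<forall>x\<in>S. x \<noteq> 0 \<longrightarrow> ip x x > 0)"

definition ip_norm :: "('a \<Rightarrow> 'a \<Rightarrow> real) \<Rightarrow> 'a \<Rightarrow> real" where
  "ip_norm ip x = sqrt (ip x x)"

definition linear_between :: "'a::real_vector set \<Rightarrow> 'b::real_vector set \<Rightarrow> ('a \<Rightarrow> 'b) \<Rightarrow> bool" where
  "linear_between S T A \<longleftrightarrow>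
     (\<forall>x\<in>S. A x \<in> T) \<and>
     (\<forall>x\<in>S. \<forall>y\<in>S. A (x + y) = A x + A y) \<and>
     (\<forall>c. \<forall>x\<in>S. A (c *\<^sub>R x) = c *\<^sub>R A x)"

definition bilinear_between ::
    "'a::real_vector set \<Rightarrow> 'b::real_vector set \<Rightarrow> 'c::real_vector set \<Rightarrow> ('a \<Rightarrow> 'b \<Rightarrow> 'c) \<Rightarrow> bool" where
  "bilinear_between S T U B \<longleftrightarrow>
     (\<forall>a\<in>S. linear_between T U (B a)) \<and> (\<forall>b\<in>T. linear_between S U (\<lambda>a. B a b))"

text \<open>
  For \<open>A\<close> defined on \<open>S\<close>, the value at \<open>y\<close> of the adjoint is the element of \<open>S\<close> representing
  the functional \<open>z \<mapsto> \<langle>y, A z\<rangle>\<close>.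
\<close>

definition adjoint_on ::
    "'a set \<Rightarrow> ('a \<Rightarrow> 'a \<Rightarrow> real) \<Rightarrow> ('b \<Rightarrow> 'b \<Rightarrow> real) \<Rightarrow> ('a \<Rightarrow> 'b) \<Rightarrow> 'b \<Rightarrow> 'a" where
  "adjoint_on S ipS ipT A y = (THE x. x \<in> S \<and> (\<forall>z\<in>S. ipS x z = ipT y (A z)))"

definition orth_proj :: "'a::real_vector set \<Rightarrow> ('a \<Rightarrow> 'a \<Rightarrow> real) \<Rightarrow> 'a \<Rightarrow> 'a" where
  "orth_proj V ip x = (THE v. v \<in> V \<and> (\<forall>w\<in>V. ip (x - v) w = 0))"

definition nonneg_selfadjoint_on :: "'a::real_vector set \<Rightarrow> ('a \<Rightarrow> 'a \<Rightarrow> real) \<Rightarrow> ('a \<Rightarrow> 'a) \<Rightarrow> bool" where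
  "nonneg_selfadjoint_on S ip A \<longleftrightarrow>
     linear_between S S A \<and>
     (\<forall>x\<in>S. \<forall>y\<in>S. ip (A x) y = ip x (A y)) \<and>
     (\<forall>x\<in>S. ip (A x) x \<ge> 0)"

text \<open>
  The square root is determined uniquely on \<open>S\<close> only, its values elsewhere are irrelevant; hence
  a choice operator instead of a definite description.
\<close>

definition op_sqrt :: "'a::real_vector set \<Rightarrow> ('a \<Rightarrow> 'a \<Rightarrow> real) \<Rightarrow> ('a \<Rightarrow> 'a) \<Rightarrow> 'a \<Rightarrow> 'a" where
  "op_sqrt S ip A = (SOME R. nonneg_selfadjoint_on S ip R \<and> (\<forall>x\<in>S. R (R x) = A x))"

definition d0_adj ::
    "('v::finite, 'e::finite, 'f::finite) complex2 \<Rightarrow> (real ^ 'v \<Rightarrow> real ^ 'v \<Rightarrow> real) \<Rightarrow>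
     (real ^ 'e \<Rightarrow> real ^ 'e \<Rightarrow> real) \<Rightarrow> real ^ 'e \<Rightarrow> real ^ 'v" where
  "d0_adj K ip0 ip1 = adjoint_on (C0 K) ip0 ip1 (d0 K)"

definition d1_adj ::
    "('v::finite, 'e::finite, 'f::finite) complex2 \<Rightarrow> (real ^ 'e \<Rightarrow> real ^ 'e \<Rightarrow> real) \<Rightarrow>
     (real ^ 'f \<Rightarrow> real ^ 'f \<Rightarrow> real) \<Rightarrow> real ^ 'f \<Rightarrow> real ^ 'e" where
  "d1_adj K ip1 ip2 = adjoint_on (C1 K) ip1 ip2 (d1 K)"

definition div_free ::
    "('v::finite, 'e::finite, 'f::finite) complex2 \<Rightarrow> (real ^ 'v \<Rightarrow> real ^ 'v \<Rightarrow> real) \<Rightarrow>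
     (real ^ 'e \<Rightarrow> real ^ 'e \<Rightarrow> real) \<Rightarrow> (real ^ 'e) set" where
  "div_free K ip0 ip1 = {v \<in> C1 K. d0_adj K ip0 ip1 v = 0}"

definition laplace1 ::
    "('v::finite, 'e::finite, 'f::finite) complex2 \<Rightarrow> (real ^ 'v \<Rightarrow> real ^ 'v \<Rightarrow> real) \<Rightarrow>
     (real ^ 'e \<Rightarrow> real ^ 'e \<Rightarrow> real) \<Rightarrow> (real ^ 'f \<Rightarrow> real ^ 'f \<Rightarrow> real) \<Rightarrow> real ^ 'e \<Rightarrow> real ^ 'e" where
  "laplace1 K ip0 ip1 ip2 x = d0 K (d0_adj K ip0 ip1 x) + d1_adj K ip1 ip2 (d1 K x)"

end

theory Submission
  imports Defs
begin

text \<open>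
  The energy identity comes from testing the two equations with \<open>u\<close> and \<open>h\<close>. By skew-symmetry
  \<open>\<langle>B(a, b), b\<rangle> = 0\<close>, which removes \<open>B(u, u)\<close> from the first equation and \<open>B(u, h)\<close> from the
  second. What remains of the nonlinearity is \<open>- \<langle>B(h, h), u\<rangle> - \<langle>B(h, u), h\<rangle>\<close>, the
  energy exchanged between the two fields, and it vanishes because the second term is the
  negative of the first, again by skew-symmetry.

  The work lies in giving meaning to the operators involved. The inner products are arbitrary
  and only meaningful on subspaces of coordinate space, while adjoints, the projector and the
  square root are given by description or choice operators. Their existence all follows from
  one fact, the spectral theorem \<open>orthonormal_eigenbasis_exists\<close>. Applied to the identity, it
  provides orthonormal bases, hence vectors representing linear functionals, hence adjoints and
  orthogonal projections. Applied to a nonnegative operator, it provides the square root,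
  by taking square roots of the eigenvalues. The Hodge Laplacian qualifies, as its
  quadratic form is \<open>\<parallel>d\<^sub>0\<^sup>* x\<parallel>\<^sup>2 + \<parallel>d\<^sub>1 x\<parallel>\<^sup>2\<close>, and so the dissipation
  \<open>\<parallel>\<Delta>\<^sub>1\<^sup>1\<^sup>/\<^sup>2 x\<parallel>\<^sup>2\<close> equals \<open>\<langle>\<Delta>\<^sub>1 x, x\<rangle>\<close>.
\<close>

section \<open>Inner products on a subspace\<close>

locale inner_product_subspace =
  fixes S :: "'a::euclidean_space set" and ip :: "'a \<Rightarrow> 'a \<Rightarrow> real"
  assumes subspace: "subspace S" and ip: "inner_product_on S ip"
begin

lemma mem:
  "0 \<in> S" "x \<in> S \<Longrightarrow> y \<in> S \<Longrightarrow> x + y \<in> S" "x \<in> S \<Longrightarrow> y \<in> S \<Longrightarrow> x - y \<in> S"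
  "x \<in> S \<Longrightarrow> c *\<^sub>R x \<in> S"
  using subspace by (auto simp: subspace_0 subspace_add subspace_diff subspace_scale)

lemma sum_mem: "(\<And>i. i \<in> I \<Longrightarrow> X i \<in> S) \<Longrightarrow> (\<Sum>i\<in>I. X i) \<in> S"
  using subspace by (simp add: subspace_sum)

lemma commute: "x \<in> S \<Longrightarrow> y \<in> S \<Longrightarrow> ip x y = ip y x"
  using ip by (auto simp: inner_product_on_def)

lemma add_left: "x \<in> S \<Longrightarrow> y \<in> S \<Longrightarrow> z \<in> S \<Longrightarrow> ip (x + y) z = ip x z + ip y z"
  using ip by (auto simp: inner_product_on_def)

lemma scale_left: "x \<in> S \<Longrightarrow> y \<in> S \<Longrightarrow> ip (c *\<^sub>R x) y = c * ip x y"
  using ip by (auto simp: inner_product_on_def)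

lemma pos: "x \<in> S \<Longrightarrow> x \<noteq> 0 \<Longrightarrow> ip x x > 0"
  using ip by (auto simp: inner_product_on_def)

lemma add_right: "x \<in> S \<Longrightarrow> y \<in> S \<Longrightarrow> z \<in> S \<Longrightarrow> ip z (x + y) = ip z x + ip z y"
  by (simp add: commute[of z] add_left mem)

lemma scale_right: "x \<in> S \<Longrightarrow> y \<in> S \<Longrightarrow> ip y (c *\<^sub>R x) = c * ip y x"
  by (simp add: commute[of y] scale_left mem)

lemma zero_left: "x \<in> S \<Longrightarrow> ip 0 x = 0"
  using scale_left[of 0 x 0] by (simp add: mem)

lemma zero_right: "x \<in> S \<Longrightarrow> ip x 0 = 0"
  by (simp add: commute[of x] zero_left mem)

lemma diff_left: "x \<in> S \<Longrightarrow> y \<in> S \<Longrightarrow> z \<in> S \<Longrightarrow> ip (x - y) z = ip x z - ip y z"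
  using add_left[of "x - y" y z] by (simp add: mem)

lemma nonneg: "x \<in> S \<Longrightarrow> ip x x \<ge> 0"
  using pos[of x] zero_left[of 0] by (cases "x = 0") (auto simp: mem)

lemma eq_zero: "x \<in> S \<Longrightarrow> ip x x = 0 \<Longrightarrow> x = 0"
  using pos[of x] by force

lemma norm_square: "x \<in> S \<Longrightarrow> (ip_norm ip x)\<^sup>2 = ip x x"
  by (simp add: ip_norm_def nonneg)

lemma eqI:
  assumes "x \<in> S" "y \<in> S" "\<And>z. z \<in> S \<Longrightarrow> ip x z = ip y z"
  shows "x = y"
proof -
  have "ip (x - y) (x - y) = 0"
    using assms by (simp add: diff_left mem)
  then show ?thesis
    using eq_zero[of "x - y"] assms by (simp add: mem)
qed

lemma sum_left:
  "(\<And>i. i \<in> I \<Longrightarrow> X i \<in> S) \<Longrightarrow> z \<in> S \<Longrightarrow> ip (\<Sum>i\<in>I. X i) z = (\<Sum>i\<in>I. ip (X i) z)"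
  by (induction I rule: infinite_finite_induct) (auto simp: zero_left add_left sum_mem)

lemma restrict:
  assumes "subspace U" "U \<subseteq> S"
  shows "inner_product_subspace U ip"
  using assms ip by unfold_locales (auto simp: inner_product_on_def subset_iff)

text \<open>
  Precomposing with a linear retraction of the whole space onto \<open>S\<close> extends the form and every linear
  map on \<open>S\<close> to total maps, to which continuity and the product rule for derivatives apply.
\<close>

lemma linear_retraction:
  obtains p where "linear p" "\<And>x. p x \<in> S" "\<And>x. x \<in> S \<Longrightarrow> p x = x"
proof -
  have "\<exists>g\<in>UNIV \<rightarrow> S. linear g \<and> (\<forall>v\<in>S. g (id v) = v)"
    using linear_exists_left_inverse_on[OF linear_id subspace] by (simp add: Pi_def image_subset_iff)
  then show ?thesis
    using that by auto
qed

lemma bounded_bilinear_extension: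
  obtains ip' where "bounded_bilinear ip'" "\<And>x y. x \<in> S \<Longrightarrow> y \<in> S \<Longrightarrow> ip' x y = ip x y"
proof -
  obtain p where p: "linear p" "\<And>x. p x \<in> S" "\<And>x. x \<in> S \<Longrightarrow> p x = x"
    by (rule linear_retraction) blast
  have "bilinear (\<lambda>x y. ip (p x) (p y))"
    unfolding bilinear_def
    by (intro conjI allI linearI)
      (simp_all add: p linear_add[OF p(1)] linear_scale[OF p(1)]
        add_left add_right scale_left scale_right)
  then have "bounded_bilinear (\<lambda>x y. ip (p x) (p y))"
    by (simp add: bilinear_conv_bounded_bilinear)
  then show ?thesis
    using p by (intro that[of "\<lambda>x y. ip (p x) (p y)"]) auto
qed

text \<open>
  The form is known to be bilinear on \<open>S\<close> only, so the product rule is applied to a bilinear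
  extension, which agrees with it along the curve at all times in \<open>T\<close>.
\<close>

lemma has_real_derivative_norm_square:
  assumes "t \<in> T" "\<And>s. s \<in> T \<Longrightarrow> w s \<in> S" "w' \<in> S"
    and "(w has_vector_derivative w') (at t within T)"
  shows "((\<lambda>s. (ip_norm ip (w s))\<^sup>2) has_real_derivative 2 * ip w' (w t)) (at t within T)"
proof -
  obtain ip' where ip': "bounded_bilinear ip'" "\<And>x y. x \<in> S \<Longrightarrow> y \<in> S \<Longrightarrow> ip' x y = ip x y"
    by (rule bounded_bilinear_extension) blast
  have "((\<lambda>s. ip' (w s) (w s)) has_vector_derivative ip' (w t) w' + ip' w' (w t)) (at t within T)"
    by (rule bounded_bilinear.has_vector_derivative[OF ip'(1) assms(4) assms(4)])
  moreover have "ip' (w t) w' + ip' w' (w t) = 2 * ip w' (w t)"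
    using assms by (simp add: ip' commute)
  ultimately have "((\<lambda>s. ip' (w s) (w s)) has_real_derivative 2 * ip w' (w t)) (at t within T)"
    by (simp add: has_real_derivative_iff_has_vector_derivative)
  then show ?thesis
    by (rule has_field_derivative_transform_within[of _ _ _ _ 1])
      (use assms in \<open>auto simp: ip' norm_square\<close>)
qed

end


section \<open>The spectral theorem\<close>

definition selfadjoint_on :: "'a::real_vector set \<Rightarrow> ('a \<Rightarrow> 'a \<Rightarrow> real) \<Rightarrow> ('a \<Rightarrow> 'a) \<Rightarrow> bool" where
  "selfadjoint_on S ip A \<longleftrightarrow>
     linear_between S S A \<and> (\<forall>x\<in>S. \<forall>y\<in>S. ip (A x) y = ip x (A y))"

lemma linear_between_sum:
  assumes "subspace S" "linear_between S U A" "\<And>i. i \<in> I \<Longrightarrow> X i \<in> S"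
  shows "A (\<Sum>i\<in>I. X i) = (\<Sum>i\<in>I. A (X i))"
proof -
  have "A (0 *\<^sub>R 0) = 0 *\<^sub>R A 0"
    using assms by (simp only: linear_between_def subspace_0)
  then have "A 0 = 0"
    by simp
  with assms(3) show ?thesis
    by (induction I rule: infinite_finite_induct)
      (use assms(1,2) in \<open>auto simp: linear_between_def subspace_sum\<close>)
qed

context inner_product_subspace
begin

text \<open>
  Moving from \<open>x\<close> a small distance in the direction \<open>- M x\<close> would make the quadratic form of \<open>M\<close>
  negative if \<open>M x\<close> were not zero.
\<close>

lemma null_vector_in_kernel:
  assumes M: "nonneg_selfadjoint_on S ip M" and x: "x \<in> S" and null: "ip (M x) x = 0"
  shows "M x = 0"
proof -
  define y where "y = M x"
  define n where "n = ip y y"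
  define c where "c = ip (M y) y"
  have lin: "\<And>x y. x \<in> S \<Longrightarrow> y \<in> S \<Longrightarrow> M (x + y) = M x + M y"
    "\<And>c x. x \<in> S \<Longrightarrow> M (c *\<^sub>R x) = c *\<^sub>R M x" "\<And>x. x \<in> S \<Longrightarrow> M x \<in> S"
    and sym: "\<And>x y. x \<in> S \<Longrightarrow> y \<in> S \<Longrightarrow> ip (M x) y = ip x (M y)"
    and nn: "\<And>x. x \<in> S \<Longrightarrow> ip (M x) x \<ge> 0"
    using M by (auto simp: nonneg_selfadjoint_on_def linear_between_def)
  have y: "y \<in> S"
    using lin x by (simp add: y_def)
  have "c \<ge> 0"
    using nn y by (simp add: c_def)
  have xy: "ip (M y) x = n"
    using sym[OF y x] by (simp add: n_def y_def)
  have "ip (M (x + t *\<^sub>R y)) (x + t *\<^sub>R y) = 2 * t * n + t\<^sup>2 * c" for t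
    using x y null xy
    by (simp add: lin mem add_left add_right scale_left scale_right flip: y_def)
      (simp add: n_def c_def power2_eq_square algebra_simps)
  then have "2 * t * n + t\<^sup>2 * c \<ge> 0" for t
    using nn[of "x + t *\<^sub>R y"] x y by (simp add: mem)
  \<comment> \<open>The choice \<open>t = - n / (c + 1)\<close> is near the minimum of this quadratic polynomial in \<open>t\<close>;
      the added 1 keeps it defined when \<open>c = 0\<close>.\<close>
  moreover have "2 * (- n / (c + 1)) * n + (- n / (c + 1))\<^sup>2 * c = - (n\<^sup>2 * (c + 2) / (c + 1)\<^sup>2)"
    using \<open>c \<ge> 0\<close> by (simp add: divide_simps power2_eq_square) (simp add: algebra_simps)
  ultimately have "n\<^sup>2 * (c + 2) / (c + 1)\<^sup>2 \<le> 0"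
    by (metis neg_0_le_iff_le)
  moreover have "n\<^sup>2 * (c + 2) / (c + 1)\<^sup>2 > 0" if "n \<noteq> 0"
    using that \<open>c \<ge> 0\<close> by simp
  ultimately have "n = 0"
    by fastforce
  then show ?thesis
    using eq_zero[OF y] by (simp add: n_def y_def)
qed

text \<open>
  An eigenvector is a maximizer \<open>x\<close> of the Rayleigh quotient, which exists because the quotient is
  continuous on the Euclidean unit sphere of \<open>S\<close> and constant along rays. If \<open>\<mu>\<close> is the maximum,
  then \<open>x\<close> is a null vector of the nonnegative operator \<open>\<mu> - A\<close>.
\<close>

lemma eigenvector_exists:
  assumes A: "selfadjoint_on S ip A" and "S \<noteq> {0}"
  obtains v \<mu> where "v \<in> S" "ip v v = 1" "A v = \<mu> *\<^sub>R v"
proof -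
  have lin: "\<And>x y. x \<in> S \<Longrightarrow> y \<in> S \<Longrightarrow> A (x + y) = A x + A y"
    "\<And>c x. x \<in> S \<Longrightarrow> A (c *\<^sub>R x) = c *\<^sub>R A x" "\<And>x. x \<in> S \<Longrightarrow> A x \<in> S"
    and sym: "\<And>x y. x \<in> S \<Longrightarrow> y \<in> S \<Longrightarrow> ip (A x) y = ip x (A y)"
    using A by (auto simp: selfadjoint_on_def linear_between_def)
  obtain ip' where ip': "bounded_bilinear ip'" "\<And>x y. x \<in> S \<Longrightarrow> y \<in> S \<Longrightarrow> ip' x y = ip x y"
    by (rule bounded_bilinear_extension) blast
  obtain p where p: "linear p" "\<And>x. p x \<in> S" "\<And>x. x \<in> S \<Longrightarrow> p x = x"
    by (rule linear_retraction) blast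
  have "linear (\<lambda>x. A (p x))"
    by (rule linearI) (simp_all add: linear_add[OF p(1)] linear_scale[OF p(1)] lin p)
  then have cA: "continuous_on X (\<lambda>x. A (p x))" for X
    by (simp add: linear_continuous_on linear_conv_bounded_linear)
  let ?X = "sphere 0 1 \<inter> S"
  have "continuous_on ?X (\<lambda>x. ip' (A (p x)) x / ip' x x)"
    using pos
    by (intro continuous_intros bounded_bilinear.continuous_on[OF ip'(1)] cA) (force simp: ip')
  then have cont: "continuous_on ?X (\<lambda>x. ip (A x) x / ip x x)"
    by (rule continuous_on_eq) (auto simp: ip' p lin)
  have "compact ?X"
    by (intro compact_Int_closed compact_sphere closed_subspace subspace)
  moreover obtain z where "z \<in> S" "z \<noteq> 0"
    using \<open>S \<noteq> {0}\<close> mem(1) by blast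
  then have "(1 / norm z) *\<^sub>R z \<in> ?X"
    by (simp add: mem)
  ultimately obtain x where x: "x \<in> ?X"
    and max: "\<And>y. y \<in> ?X \<Longrightarrow> ip (A y) y / ip y y \<le> ip (A x) x / ip x x"
    using continuous_attains_sup[OF _ _ cont] by blast
  define \<mu> where "\<mu> = ip (A x) x / ip x x"
  define M where "M = (\<lambda>y. \<mu> *\<^sub>R y - A y)"
  have xS: "x \<in> S" "ip x x > 0"
    using x pos by force+
  have "ip (A y) y \<le> \<mu> * ip y y" if y: "y \<in> S" for y
  proof (cases "y = 0")
    case True
    then show ?thesis
      using lin y by (simp add: zero_right mem)
  next
    case False
    define r where "r = 1 / norm y"
    have "ip (A (r *\<^sub>R y)) (r *\<^sub>R y) / ip (r *\<^sub>R y) (r *\<^sub>R y) \<le> \<mu>"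
      unfolding \<mu>_def using y False by (intro max) (simp add: r_def mem)
    moreover have "r \<noteq> 0"
      using False by (simp add: r_def)
    ultimately have "ip (A y) y / ip y y \<le> \<mu>"
      using y by (simp add: lin mem scale_left scale_right)
    then show ?thesis
      using pos[OF y False] by (simp add: field_simps)
  qed
  moreover have form: "ip (M y) z = \<mu> * ip y z - ip (A y) z" if "y \<in> S" "z \<in> S" for y z
    using that by (simp add: M_def diff_left scale_left lin mem)
  moreover have MS: "M y \<in> S" if "y \<in> S" for y
    using that by (simp add: M_def lin mem)
  moreover have "linear_between S S M"
    unfolding linear_between_def using MS by (simp add: M_def lin algebra_simps)
  moreover have "ip (M y) z = ip y (M z)" if y: "y \<in> S" and z: "z \<in> S" for y z
    using form[OF y z] form[OF z y] commute[OF y z] commute[OF y MS[OF z]]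
      sym[OF y z] commute[OF y lin(3)[OF z]] by simp
  ultimately have "nonneg_selfadjoint_on S ip M"
    by (simp add: nonneg_selfadjoint_on_def)
  moreover have "ip (M x) x = 0"
    using xS by (simp add: M_def diff_left scale_left lin mem \<mu>_def)
  ultimately have "A x = \<mu> *\<^sub>R x"
    using null_vector_in_kernel[of M x] xS by (simp add: M_def)
  with xS show ?thesis
    by (intro that[of "(1 / sqrt (ip x x)) *\<^sub>R x" \<mu>])
      (auto simp: lin mem scale_left scale_right)
qed

end

text \<open>
  The orthogonal complement of an eigenvector within \<open>S\<close> is invariant under the operator and has
  smaller dimension, so that an eigenbasis can be built by induction.
\<close>

lemma orthonormal_eigenbasis_exists:
  fixes S :: "'a::euclidean_space set"
  assumes "inner_product_subspace S ip" "selfadjoint_on S ip A"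
  obtains \<B> where "finite \<B>" "\<B> \<subseteq> S"
    "\<And>b c. b \<in> \<B> \<Longrightarrow> c \<in> \<B> \<Longrightarrow> ip b c = (if b = c then 1 else 0)"
    "\<And>x. x \<in> S \<Longrightarrow> (\<Sum>b\<in>\<B>. ip x b *\<^sub>R b) = x"
    "\<And>b. b \<in> \<B> \<Longrightarrow> \<exists>\<mu>. A b = \<mu> *\<^sub>R b"
proof -
  have "\<exists>\<B>. finite \<B> \<and> \<B> \<subseteq> S \<and>
      (\<forall>b\<in>\<B>. \<forall>c\<in>\<B>. ip b c = (if b = c then 1 else 0)) \<and>
      (\<forall>x\<in>S. (\<Sum>b\<in>\<B>. ip x b *\<^sub>R b) = x) \<and> (\<forall>b\<in>\<B>. \<exists>\<mu>. A b = \<mu> *\<^sub>R b)"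
    using assms
  proof (induction "dim S" arbitrary: S rule: less_induct)
    case less
    interpret inner_product_subspace S ip
      by fact
    show ?case
    proof (cases "S = {0}")
      case True
      then show ?thesis
        by (intro exI[of _ "{}"]) auto
    next
      case False
      obtain v \<mu> where v: "v \<in> S" "ip v v = 1" "A v = \<mu> *\<^sub>R v"
        using eigenvector_exists[OF less.prems(2) False] by blast
      define U where "U = {x \<in> S. ip x v = 0}"
      have U: "subspace U" "U \<subseteq> S"
        using v by (auto simp: subspace_def U_def mem zero_left add_left scale_left)
      moreover have "v \<in> S - U"
        using v by (simp add: U_def)
      ultimately have "dim U < dim S"
        by (intro dim_psubset) (auto simp: span_eq_iff[THEN iffD2] subspace)
      moreover have "A x \<in> U" if "x \<in> U" for x
        using that v less.prems(2)
        by (auto simp: U_def selfadjoint_on_def linear_between_def scale_right)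
      then have "selfadjoint_on U ip A"
        using less.prems(2) U unfolding selfadjoint_on_def linear_between_def
        by (auto simp: subset_iff)
      ultimately obtain \<C> where \<C>: "finite \<C>" "\<C> \<subseteq> U"
        "\<And>b c. b \<in> \<C> \<Longrightarrow> c \<in> \<C> \<Longrightarrow> ip b c = (if b = c then 1 else 0)"
        "\<And>x. x \<in> U \<Longrightarrow> (\<Sum>b\<in>\<C>. ip x b *\<^sub>R b) = x"
        "\<And>b. b \<in> \<C> \<Longrightarrow> \<exists>\<mu>. A b = \<mu> *\<^sub>R b"
        using less.hyps[of U] restrict[OF U] by (smt (verit))
      have \<C>v: "c \<in> S \<and> ip c v = 0 \<and> ip v c = 0" if "c \<in> \<C>" for c
      proof -
        have "c \<in> S" "ip c v = 0"
          using that \<C>(2) by (auto simp: U_def)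
        with commute[OF v(1)] show ?thesis
          by metis
      qed
      then have "v \<notin> \<C>"
        using v by force
      note v\<C> = this \<C>v
      have "(\<Sum>b\<in>insert v \<C>. ip x b *\<^sub>R b) = x" if x: "x \<in> S" for x
      proof -
        have "x - ip x v *\<^sub>R v \<in> U"
          using x v by (simp add: U_def mem diff_left scale_left)
        then have "(\<Sum>b\<in>\<C>. ip (x - ip x v *\<^sub>R v) b *\<^sub>R b) = x - ip x v *\<^sub>R v"
          by (rule \<C>(4))
        moreover have "(\<Sum>b\<in>\<C>. ip (x - ip x v *\<^sub>R v) b *\<^sub>R b) = (\<Sum>b\<in>\<C>. ip x b *\<^sub>R b)"
          using x v v\<C> by (intro sum.cong refl) (simp add: mem diff_left scale_left)
        ultimately show ?thesis
          using \<C>(1) v\<C>(1) by simp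
      qed
      then show ?thesis
        using v v\<C> \<C> by (intro exI[of _ "insert v \<C>"]) (auto 0 3)
    qed
  qed
  then show ?thesis
    using that by (elim exE conjE) metis
qed


section \<open>Square roots, representing vectors and projections\<close>

context inner_product_subspace
begin

text \<open>
  The square root acts on an orthonormal eigenbasis by the square roots of the eigenvalues
  \<open>\<mu> b = \<langle>A b, b\<rangle>\<close>.
\<close>

lemma square_root_exists:
  assumes A: "nonneg_selfadjoint_on S ip A"
  obtains R where "nonneg_selfadjoint_on S ip R" "\<And>x. x \<in> S \<Longrightarrow> R (R x) = A x"
proof -
  have sa: "selfadjoint_on S ip A"
    using A by (simp add: selfadjoint_on_def nonneg_selfadjoint_on_def)
  obtain \<B> where \<B>: "finite \<B>" "\<B> \<subseteq> S"
    "\<And>b c. b \<in> \<B> \<Longrightarrow> c \<in> \<B> \<Longrightarrow> ip b c = (if b = c then 1 else 0)"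
    "\<And>x. x \<in> S \<Longrightarrow> (\<Sum>b\<in>\<B>. ip x b *\<^sub>R b) = x"
    "\<And>b. b \<in> \<B> \<Longrightarrow> \<exists>\<mu>. A b = \<mu> *\<^sub>R b"
    by (rule orthonormal_eigenbasis_exists[OF inner_product_subspace_axioms sa]) blast
  have \<B>S: "b \<in> S" if "b \<in> \<B>" for b
    using \<B> that by blast
  define \<mu> where "\<mu> b = ip (A b) b" for b
  define R where "R x = (\<Sum>b\<in>\<B>. (sqrt (\<mu> b) * ip x b) *\<^sub>R b)" for x
  have \<mu>: "\<mu> b \<ge> 0" "A b = \<mu> b *\<^sub>R b" if "b \<in> \<B>" for b
    using A \<B>(5)[OF that] \<B>(3)[of b b] \<B>S[OF that] that
    by (auto simp: \<mu>_def nonneg_selfadjoint_on_def scale_left scale_right)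
  have RS: "R x \<in> S" for x
    unfolding R_def by (intro sum_mem mem(4) \<B>S)
  have ipR: "ip (R x) y = (\<Sum>b\<in>\<B>. sqrt (\<mu> b) * ip x b * ip y b)" if "y \<in> S" for x y
    using that commute[OF that \<B>S] by (simp add: R_def sum_left mem \<B>S scale_left)
  have "nonneg_selfadjoint_on S ip R"
    unfolding nonneg_selfadjoint_on_def linear_between_def
  proof (intro conjI ballI allI)
    fix x y assume x: "x \<in> S" and y: "y \<in> S"
    show "R (x + y) = R x + R y"
      using x y by (simp add: R_def add_left \<B>S sum.distrib[symmetric] algebra_simps)
    show "ip (R x) y = ip x (R y)"
      using x y RS by (simp add: commute[of x] ipR mult_ac)
  next
    fix c x assume "x \<in> S"
    then show "R (c *\<^sub>R x) = c *\<^sub>R R x"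
      by (simp add: R_def scale_left \<B>S scaleR_sum_right mult_ac)
  next
    fix x assume "x \<in> S"
    then show "ip (R x) x \<ge> 0"
      by (simp add: ipR \<mu> mult.assoc sum_nonneg)
  qed (rule RS)
  moreover have "R (R x) = A x" if x: "x \<in> S" for x
  proof -
    have Ax: "A x \<in> S"
      using A x by (simp add: nonneg_selfadjoint_on_def linear_between_def)
    have "sqrt (\<mu> b) * ip (R x) b = ip (A x) b" if b: "b \<in> \<B>" for b
    proof -
      have "ip (R x) b = (\<Sum>c\<in>\<B>. if b = c then sqrt (\<mu> c) * ip x c else 0)"
        using b by (subst ipR) (auto simp: \<B>S \<B>(3) intro!: sum.cong)
      then have "ip (R x) b = sqrt (\<mu> b) * ip x b"
        using \<B>(1) b by simp
      then have "sqrt (\<mu> b) * ip (R x) b = \<mu> b * ip x b"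
        using \<mu>[OF b] by simp
      also have "\<dots> = ip x (A b)"
        using \<mu>[OF b] x b by (simp add: scale_right \<B>S)
      also have "\<dots> = ip (A x) b"
        using A x b by (simp add: nonneg_selfadjoint_on_def \<B>S)
      finally show ?thesis .
    qed
    then have "R (R x) = (\<Sum>b\<in>\<B>. ip (A x) b *\<^sub>R b)"
      by (simp add: R_def[of "R x"])
    then show ?thesis
      using \<B>(4)[OF Ax] by simp
  qed
  ultimately show ?thesis
    using that by blast
qed

text \<open>
  Any self-adjoint \<open>R\<close> with \<open>R\<^sup>2 = A\<close> satisfies \<open>\<langle>R x, R x\<rangle> = \<langle>R\<^sup>2 x, x\<rangle> = \<langle>A x, x\<rangle>\<close>, so it does not
  matter which square root the choice operator selects.
\<close>

lemma norm_square_op_sqrt: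
  assumes A: "nonneg_selfadjoint_on S ip A" and x: "x \<in> S"
  shows "(ip_norm ip (op_sqrt S ip A x))\<^sup>2 = ip (A x) x"
proof -
  let ?R = "op_sqrt S ip A"
  have "\<exists>R. nonneg_selfadjoint_on S ip R \<and> (\<forall>x\<in>S. R (R x) = A x)"
    using square_root_exists[OF A] by metis
  then have R: "nonneg_selfadjoint_on S ip ?R \<and> (\<forall>x\<in>S. ?R (?R x) = A x)"
    unfolding op_sqrt_def by (rule someI_ex)
  then have RS: "?R x \<in> S"
    using x by (simp add: nonneg_selfadjoint_on_def linear_between_def)
  have "ip (?R x) (?R x) = ip (?R (?R x)) x"
    using R RS x by (metis nonneg_selfadjoint_on_def)
  then show ?thesis
    using R RS x by (simp add: norm_square)
qed

lemma orthonormal_basis_exists: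
  obtains \<B> where "finite \<B>" "\<B> \<subseteq> S"
    "\<And>b c. b \<in> \<B> \<Longrightarrow> c \<in> \<B> \<Longrightarrow> ip b c = (if b = c then 1 else 0)"
    "\<And>x. x \<in> S \<Longrightarrow> (\<Sum>b\<in>\<B>. ip x b *\<^sub>R b) = x"
proof -
  have "selfadjoint_on S ip (\<lambda>x. x)"
    by (simp add: selfadjoint_on_def linear_between_def mem)
  then show ?thesis
    using that by (rule orthonormal_eigenbasis_exists[OF inner_product_subspace_axioms]) blast
qed

text \<open>
  On an orthonormal basis \<open>\<B>\<close> the representing vector is \<open>\<Sum>b\<in>\<B>. \<phi>(b) b\<close>. Existence and uniqueness
  together turn the description operators for adjoints and projections into actual vectors.
\<close>

lemma riesz_representation:
  assumes "linear_between S UNIV \<phi>"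
  shows "\<exists>!w. w \<in> S \<and> (\<forall>z\<in>S. ip w z = \<phi> z)"
proof -
  obtain \<B> where \<B>: "finite \<B>" "\<B> \<subseteq> S" "\<And>x. x \<in> S \<Longrightarrow> (\<Sum>b\<in>\<B>. ip x b *\<^sub>R b) = x"
    by (rule orthonormal_basis_exists) blast
  have \<B>S: "b \<in> S" if "b \<in> \<B>" for b
    using \<B> that by blast
  let ?w = "\<Sum>b\<in>\<B>. \<phi> b *\<^sub>R b"
  have "ip ?w z = \<phi> z" if z: "z \<in> S" for z
  proof -
    have "\<phi> z = \<phi> (\<Sum>b\<in>\<B>. ip z b *\<^sub>R b)"
      using \<B>(3)[OF z] by simp
    also have "\<dots> = (\<Sum>b\<in>\<B>. \<phi> (ip z b *\<^sub>R b))"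
      by (rule linear_between_sum[OF subspace assms]) (simp add: mem \<B>S)
    also have "\<dots> = (\<Sum>b\<in>\<B>. \<phi> b * ip b z)"
      using assms z by (intro sum.cong refl) (simp add: linear_between_def \<B>S commute[of z])
    also have "\<dots> = ip ?w z"
      using z by (simp add: sum_left mem \<B>S scale_left)
    finally show ?thesis
      by simp
  qed
  moreover have "?w \<in> S"
    by (simp add: sum_mem mem \<B>S)
  ultimately show ?thesis
    using eqI by (intro ex1I[of _ ?w]) auto
qed

lemma adjoint_on:
  assumes U: "inner_product_subspace U ipU" and A: "linear_between S U A" and y: "y \<in> U"
  shows adjoint_on_mem: "adjoint_on S ip ipU A y \<in> S"
    and adjoint_on_ip: "z \<in> S \<Longrightarrow> ip (adjoint_on S ip ipU A y) z = ipU y (A z)"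
proof -
  interpret U: inner_product_subspace U ipU
    by fact
  have "linear_between S UNIV (\<lambda>z. ipU y (A z))"
    using A y by (simp add: linear_between_def U.add_right U.scale_right)
  from theI'[OF riesz_representation[OF this]]
  show "adjoint_on S ip ipU A y \<in> S"
    and "z \<in> S \<Longrightarrow> ip (adjoint_on S ip ipU A y) z = ipU y (A z)"
    unfolding adjoint_on_def by auto
qed

lemma linear_between_adjoint_on:
  assumes U: "inner_product_subspace U ipU" and A: "linear_between S U A"
  shows "linear_between U S (adjoint_on S ip ipU A)"
proof -
  interpret U: inner_product_subspace U ipU
    by fact
  note adj = adjoint_on[OF U A]
  have AU: "z \<in> S \<Longrightarrow> A z \<in> U" for z
    using A by (simp add: linear_between_def)
  show ?thesis
    unfolding linear_between_def
    by (intro conjI ballI allI eqI)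
      (simp_all add: adj mem U.mem add_left scale_left U.add_left U.scale_left AU)
qed

text \<open>
  The projection of \<open>x\<close> is the vector of \<open>V\<close> that represents the functional \<open>\<langle>x, _\<rangle>\<close> on \<open>V\<close>.
\<close>

lemma orth_proj_mem:
  assumes V: "subspace V" "V \<subseteq> S" and x: "x \<in> S"
  shows "orth_proj V ip x \<in> V"
proof -
  interpret V: inner_product_subspace V ip
    by (rule restrict[OF V])
  have "linear_between V UNIV (ip x)"
    using V x by (simp add: linear_between_def add_right scale_right subset_iff)
  then have "\<exists>!v. v \<in> V \<and> (\<forall>w\<in>V. ip v w = ip x w)"
    by (rule V.riesz_representation)
  moreover have "(\<forall>w\<in>V. ip (x - v) w = 0) \<longleftrightarrow> (\<forall>w\<in>V. ip v w = ip x w)" if "v \<in> V" for v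
    using V x that by (auto simp: diff_left subset_iff)
  ultimately have "\<exists>!v. v \<in> V \<and> (\<forall>w\<in>V. ip (x - v) w = 0)"
    by metis
  from theI'[OF this] show ?thesis
    by (simp add: orth_proj_def)
qed

end


section \<open>The Hodge Laplacian on edge cochains\<close>

lemma subspace_C0: "subspace (C0 K)" and subspace_C1: "subspace (C1 K)"
  and subspace_C2: "subspace (C2 K)"
  by (auto simp: subspace_def C0_def C1_def C2_def)

lemma linear_between_d0: "linear_between (C0 K) (C1 K) (d0 K)"
  by (simp add: linear_between_def d0_C1 linear_add[OF linear_d0] linear_scale[OF linear_d0])

lemma linear_between_d1: "linear_between (C1 K) (C2 K) (d1 K)"
  by (simp add: linear_between_def d1_C2 linear_add[OF linear_d1] linear_scale[OF linear_d1])

lemma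
  assumes "inner_product_on (C0 K) ip0" "inner_product_on (C1 K) ip1"
  shows linear_between_d0_adj: "linear_between (C1 K) (C0 K) (d0_adj K ip0 ip1)"
    and d0_adj_ip: "x \<in> C1 K \<Longrightarrow> z \<in> C0 K \<Longrightarrow> ip0 (d0_adj K ip0 ip1 x) z = ip1 x (d0 K z)"
proof -
  interpret C0: inner_product_subspace "C0 K" ip0
    using assms by unfold_locales (simp_all add: subspace_C0)
  interpret C1: inner_product_subspace "C1 K" ip1
    using assms by unfold_locales (simp_all add: subspace_C1)
  note d0 = C1.inner_product_subspace_axioms linear_between_d0
  show "linear_between (C1 K) (C0 K) (d0_adj K ip0 ip1)"
    unfolding d0_adj_def by (rule C0.linear_between_adjoint_on[OF d0])
  show "x \<in> C1 K \<Longrightarrow> z \<in> C0 K \<Longrightarrow> ip0 (d0_adj K ip0 ip1 x) z = ip1 x (d0 K z)"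
    unfolding d0_adj_def by (rule C0.adjoint_on_ip[OF d0])
qed

lemma
  assumes "inner_product_on (C1 K) ip1" "inner_product_on (C2 K) ip2"
  shows linear_between_d1_adj: "linear_between (C2 K) (C1 K) (d1_adj K ip1 ip2)"
    and d1_adj_ip: "y \<in> C2 K \<Longrightarrow> z \<in> C1 K \<Longrightarrow> ip1 (d1_adj K ip1 ip2 y) z = ip2 y (d1 K z)"
proof -
  interpret C1: inner_product_subspace "C1 K" ip1
    using assms by unfold_locales (simp_all add: subspace_C1)
  interpret C2: inner_product_subspace "C2 K" ip2
    using assms by unfold_locales (simp_all add: subspace_C2)
  note d1 = C2.inner_product_subspace_axioms linear_between_d1
  show "linear_between (C2 K) (C1 K) (d1_adj K ip1 ip2)"
    unfolding d1_adj_def by (rule C1.linear_between_adjoint_on[OF d1])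
  show "y \<in> C2 K \<Longrightarrow> z \<in> C1 K \<Longrightarrow> ip1 (d1_adj K ip1 ip2 y) z = ip2 y (d1 K z)"
    unfolding d1_adj_def by (rule C1.adjoint_on_ip[OF d1])
qed

text \<open>
  Moving each operator across the inner product turns the form of \<open>\<Delta>\<^sub>1\<close> into
  \<open>\<langle>d\<^sub>0\<^sup>* x, d\<^sub>0\<^sup>* y\<rangle> + \<langle>d\<^sub>1 x, d\<^sub>1 y\<rangle>\<close>, which is visibly symmetric and nonnegative.
\<close>

lemma nonneg_selfadjoint_laplace1:
  assumes ip0: "inner_product_on (C0 K) ip0" and ip1: "inner_product_on (C1 K) ip1"
    and ip2: "inner_product_on (C2 K) ip2"
  shows "nonneg_selfadjoint_on (C1 K) ip1 (laplace1 K ip0 ip1 ip2)"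
proof -
  interpret C0: inner_product_subspace "C0 K" ip0
    using ip0 by unfold_locales (simp_all add: subspace_C0)
  interpret C1: inner_product_subspace "C1 K" ip1
    using ip1 by unfold_locales (simp_all add: subspace_C1)
  interpret C2: inner_product_subspace "C2 K" ip2
    using ip2 by unfold_locales (simp_all add: subspace_C2)
  note lin = linear_between_d0_adj[OF ip0 ip1, unfolded linear_between_def]
    linear_between_d1_adj[OF ip1 ip2, unfolded linear_between_def]
    linear_between_d0[of K, unfolded linear_between_def]
    linear_between_d1[of K, unfolded linear_between_def]
  have form: "ip1 (laplace1 K ip0 ip1 ip2 x) y =
      ip0 (d0_adj K ip0 ip1 x) (d0_adj K ip0 ip1 y) + ip2 (d1 K x) (d1 K y)"
    if x: "x \<in> C1 K" and y: "y \<in> C1 K" for x y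
  proof -
    have "ip1 (laplace1 K ip0 ip1 ip2 x) y =
        ip1 y (d0 K (d0_adj K ip0 ip1 x)) + ip1 (d1_adj K ip1 ip2 (d1 K x)) y"
      using x y lin C1.commute[of y "d0 K (d0_adj K ip0 ip1 x)"]
      by (simp add: laplace1_def C1.add_left)
    also have "\<dots> = ip0 (d0_adj K ip0 ip1 y) (d0_adj K ip0 ip1 x) + ip2 (d1 K x) (d1 K y)"
      using x y lin by (simp add: d0_adj_ip[OF ip0 ip1] d1_adj_ip[OF ip1 ip2])
    finally show ?thesis
      using x y lin by (simp add: C0.commute)
  qed
  have mem: "laplace1 K ip0 ip1 ip2 x \<in> C1 K" if "x \<in> C1 K" for x
    using that lin by (simp add: laplace1_def C1.mem)
  show ?thesis
    unfolding nonneg_selfadjoint_on_def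
  proof (intro conjI ballI)
    show "linear_between (C1 K) (C1 K) (laplace1 K ip0 ip1 ip2)"
      unfolding linear_between_def using mem lin by (simp add: laplace1_def algebra_simps)
  next
    fix x y assume "x \<in> C1 K" "y \<in> C1 K"
    then show "ip1 (laplace1 K ip0 ip1 ip2 x) y = ip1 x (laplace1 K ip0 ip1 ip2 y)"
      using lin by (simp add: C1.commute[of x] mem form C0.commute C2.commute)
  next
    fix x assume "x \<in> C1 K"
    then show "ip1 (laplace1 K ip0 ip1 ip2 x) x \<ge> 0"
      using lin by (simp add: form C0.nonneg C2.nonneg)
  qed
qed

lemma subspace_div_free:
  assumes "inner_product_on (C0 K) ip0" "inner_product_on (C1 K) ip1"
  shows "subspace (div_free K ip0 ip1)"
proof -
  note lin = linear_between_d0_adj[OF assms]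
  have "d0_adj K ip0 ip1 0 = 0"
    using linear_between_sum[OF subspace_C1 lin, of "{}"] by simp
  then show ?thesis
    using lin subspace_C1[of K] by (simp add: subspace_def div_free_def linear_between_def)
qed


section \<open>The energy identity\<close>

theorem theorem2:
  fixes K :: "('v::finite, 'e::finite, 'f::finite) complex2"
    and ip0 :: "real ^ 'v \<Rightarrow> real ^ 'v \<Rightarrow> real"
    and ip1 :: "real ^ 'e \<Rightarrow> real ^ 'e \<Rightarrow> real"
    and ip2 :: "real ^ 'f \<Rightarrow> real ^ 'f \<Rightarrow> real"
    and V :: "(real ^ 'e) set"
    and P \<Delta>1 :: "real ^ 'e \<Rightarrow> real ^ 'e"
    and B :: "real ^ 'e \<Rightarrow> real ^ 'e \<Rightarrow> real ^ 'e"
    and \<nu> \<eta> :: real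
    and f g :: "real ^ 'e"
    and T :: "real set"
    and u h :: "real \<Rightarrow> real ^ 'e"
    and E :: "real \<Rightarrow> real"
  assumes K: "cell_complex2 K"
    and ip0: "inner_product_on (C0 K) ip0"
    and ip1: "inner_product_on (C1 K) ip1"
    and ip2: "inner_product_on (C2 K) ip2"
    and V: "V = div_free K ip0 ip1"
    and P: "P = orth_proj V ip1"
    and \<Delta>1: "\<Delta>1 = laplace1 K ip0 ip1 ip2"
    and \<nu>: "\<nu> > 0" and \<eta>: "\<eta> > 0"
    and f: "f \<in> C1 K" and g: "g \<in> C1 K"
    and B_bilinear: "bilinear_between V V V B"
    and B_continuous: "continuous_on (V \<times> V) (\<lambda>(a, b). B a b)"
    and B_skew: "\<forall>a\<in>V. \<forall>b\<in>V. \<forall>c\<in>V. ip1 (B a b) c = - ip1 (B a c) b"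
    and T: "is_interval T" "interior T \<noteq> {}"
    and u_V: "\<forall>t\<in>T. u t \<in> V" and h_V: "\<forall>t\<in>T. h t \<in> V"
    and u_eq: "\<forall>t\<in>T. (u has_vector_derivative
        - \<nu> *\<^sub>R \<Delta>1 (u t) + B (u t) (u t) - B (h t) (h t) + P f) (at t within T)"
    and h_eq: "\<forall>t\<in>T. (h has_vector_derivative
        - \<eta> *\<^sub>R \<Delta>1 (h t) + B (u t) (h t) - B (h t) (u t) + P g) (at t within T)"
    and E: "E = (\<lambda>t. (ip_norm ip1 (u t))\<^sup>2 + (ip_norm ip1 (h t))\<^sup>2)"
  shows "\<forall>t\<in>T. \<exists>E'. (E has_real_derivative E') (at t within T) \<and>
     1 / 2 * E' + \<nu> * (ip_norm ip1 (op_sqrt (C1 K) ip1 \<Delta>1 (u t)))\<^sup>2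
                + \<eta> * (ip_norm ip1 (op_sqrt (C1 K) ip1 \<Delta>1 (h t)))\<^sup>2
       = ip1 (P f) (u t) + ip1 (P g) (h t)"
proof
  fix t assume t: "t \<in> T"
  interpret C1: inner_product_subspace "C1 K" ip1
    using ip1 by unfold_locales (simp_all add: subspace_C1)
  have "subspace V" "V \<subseteq> C1 K"
    using subspace_div_free[OF ip0 ip1] by (auto simp: V div_free_def)
  then have PV: "P f \<in> V" "P g \<in> V" and VC: "\<And>x. x \<in> V \<Longrightarrow> x \<in> C1 K"
    using f g C1.orth_proj_mem by (auto simp: P)
  have uV: "u t \<in> V" and hV: "h t \<in> V"
    using t u_V h_V by auto
  have BV: "B a b \<in> V" if "a \<in> V" "b \<in> V" for a b
    using B_bilinear that by (simp add: bilinear_between_def linear_between_def)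
  have L: "nonneg_selfadjoint_on (C1 K) ip1 \<Delta>1"
    unfolding \<Delta>1 using ip0 ip1 ip2 by (rule nonneg_selfadjoint_laplace1)
  then have LC: "\<Delta>1 x \<in> C1 K" if "x \<in> C1 K" for x
    using that by (simp add: nonneg_selfadjoint_on_def linear_between_def)
  note C = VC[OF uV] VC[OF hV] VC[OF PV(1)] VC[OF PV(2)] VC[OF BV] LC
  let ?u' = "- \<nu> *\<^sub>R \<Delta>1 (u t) + B (u t) (u t) - B (h t) (h t) + P f"
  let ?h' = "- \<eta> *\<^sub>R \<Delta>1 (h t) + B (u t) (h t) - B (h t) (u t) + P g"
  have C': "?u' \<in> C1 K" "?h' \<in> C1 K"
    by (intro C1.mem C uV hV)+
  have "((\<lambda>s. (ip_norm ip1 (u s))\<^sup>2) has_real_derivative 2 * ip1 ?u' (u t)) (at t within T)"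
    "((\<lambda>s. (ip_norm ip1 (h s))\<^sup>2) has_real_derivative 2 * ip1 ?h' (h t)) (at t within T)"
    using t u_V h_V u_eq h_eq VC C' by (auto intro!: C1.has_real_derivative_norm_square)
  then have "(E has_real_derivative 2 * ip1 ?u' (u t) + 2 * ip1 ?h' (h t)) (at t within T)"
    unfolding E by (rule DERIV_add)
  moreover have "ip1 ?u' (u t) = - \<nu> * ip1 (\<Delta>1 (u t)) (u t) + ip1 (B (u t) (u t)) (u t)
      - ip1 (B (h t) (h t)) (u t) + ip1 (P f) (u t)"
    by (subst C1.add_left C1.diff_left C1.scale_left; (intro C1.mem C uV hV)?)+ simp
  moreover have "ip1 ?h' (h t) = - \<eta> * ip1 (\<Delta>1 (h t)) (h t) + ip1 (B (u t) (h t)) (h t)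
      - ip1 (B (h t) (u t)) (h t) + ip1 (P g) (h t)"
    by (subst C1.add_left C1.diff_left C1.scale_left; (intro C1.mem C uV hV)?)+ simp
  \<comment> \<open>The terms with \<open>B (u t)\<close> vanish, and the two with \<open>B (h t)\<close>, which exchange energy between
      the fields, cancel.\<close>
  moreover have "ip1 (B (u t) (u t)) (u t) = 0" "ip1 (B (u t) (h t)) (h t) = 0"
    "ip1 (B (h t) (u t)) (h t) = - ip1 (B (h t) (h t)) (u t)"
    using B_skew[rule_format, OF uV uV uV] B_skew[rule_format, OF uV hV hV]
      B_skew[rule_format, OF hV uV hV] by simp_all
  moreover have "(ip_norm ip1 (op_sqrt (C1 K) ip1 \<Delta>1 (u t)))\<^sup>2 = ip1 (\<Delta>1 (u t)) (u t)"
    "(ip_norm ip1 (op_sqrt (C1 K) ip1 \<Delta>1 (h t)))\<^sup>2 = ip1 (\<Delta>1 (h t)) (h t)"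
    using C1.norm_square_op_sqrt[OF L] C by auto
  ultimately show "\<exists>E'. (E has_real_derivative E') (at t within T) \<and>
     1 / 2 * E' + \<nu> * (ip_norm ip1 (op_sqrt (C1 K) ip1 \<Delta>1 (u t)))\<^sup>2
                + \<eta> * (ip_norm ip1 (op_sqrt (C1 K) ip1 \<Delta>1 (h t)))\<^sup>2
       = ip1 (P f) (u t) + ip1 (P g) (h t)"
    by (intro exI[of _ "2 * ip1 ?u' (u t) + 2 * ip1 ?h' (h t)"])
      (simp add: algebra_simps)
qed

end
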